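(* Let $p>1$, let $\overline{m},\underline{m}\in\mathbb{R}$, and let $Z_n$, $n\ge 1$, be a sequence of random variables such that each $Z_n$ is $\varphi_p$-sub-Gaussian under $\hat{\mathbb{E}}$ with the same parameters $\overline{m}$ and $\underline{m}$ (the parameter $a$ may depend on $n$). Let $\tau_{\varphi_p}(Z_n)$ be defined with respect to these fixed $\overline{m}$ and $\underline{m}$. If there exist positive numbers $c$ and $\alpha$ such that $\tau_{\varphi_p}(Z_n)\le c\,n^{-\alpha}$ for every natural number $n\ge 1$, then $$\hat{\mathbb{V}}\left(\left\{\liminf_{n\to\infty} Z_n<\underline{m}\right\}\cup\left\{\limsup_{n\to\infty} Z_n>\overline{m}\right\}\right)=0$$ and $$v\left(\underline{m}\le \liminf_{n\to\infty} Z_n\le \limsup_{n\to\infty} Z_n\le \overline{m}\right)=1.$$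
   Context: **Sub-linear expectation space.** Let $\Omega$ be a non-empty set and $\mathcal{F}$ a $\sigma$-algebra of subsets of $\Omega$. A random variable is an extended real-valued function $X$ on $\Omega$ with $X^{-1}(A)\in\mathcal{F}$ for every Borel set $A$. Let $\mathcal{H}$ be a set of random variables containing all non-negative random variables. A sub-linear expectation is an extended real-valued function $\hat{\mathbb{E}}[X]$ of $X\in\mathcal{H}$ such that (for elements of $\mathcal{H}$, whenever the expressions involved are well defined): 1. (monotone) if $X\le Y$ then $\hat{\mathbb{E}}[X]\le\hat{\mathbb{E}}[Y]$; 2. (constant preserving) $\hat{\mathbb{E}}[c]=c$ for every $c\in\mathbb{R}$; 3. (sub-additive) $\hat{\mathbb{E}}[X+Y]\le\hat{\mathbb{E}}[X]+\hat{\mathbb{E}}[Y]$, where the case $\hat{\mathbb{E}}[X]+\hat{\mathbb{E}}[Y]=\infty+(-\infty)$ is excluded; 4. (positive homogeneous) $\hat{\mathbb{E}}[\lambda X]=\lambda\hat{\mathbb{E}}[X]$ for every constant $\lambda\ge 0$; 5. (monotone convergence) if $X_n\uparrow X$ and $X_1\ge 0$, then $\hat{\mathbb{E}}[X_n]\uparrow\hat{\mathbb{E}}[X]$. Throughout, such a sub-linear expectation $\hat{\mathbb{E}}$ is given, and the upper probability $\hat{\mathbb{V}}$ on $(\Omega,\mathcal{F})$ satisfies $\hat{\mathbb{V}}(A)=\hat{\mathbb{E}}[\mathbb{I}_A]$ for $A\in\mathcal{F}$, where $\mathbb{I}_A$ is the indicator of $A$. Thus $\hat{\mathbb{V}}$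 is normalized ($\hat{\mathbb{V}}(\Omega)=1$, $\hat{\mathbb{V}}(\emptyset)=0$), monotone, sub-additive ($\hat{\mathbb{V}}(A\cup B)\le\hat{\mathbb{V}}(A)+\hat{\mathbb{V}}(B)$) and lower-continuous ($A_n\uparrow A$ implies $\hat{\mathbb{V}}(A_n)\uparrow\hat{\mathbb{V}}(A)$). The lower capacity is $v(A)=1-\hat{\mathbb{V}}(A^c)$. An event $A$ is quasi-sure (q.s.) if $\hat{\mathbb{V}}(A^c)=0$; relations between random variables are understood quasi-surely. **$N$-functions.** An $N$-function is a real continuous even convex function $\varphi(x)$, $x\in\mathbb{R}$, such that $\varphi(0)=0$, $\varphi$ is monotone increasing for $x>0$, $\lim_{x\to0}\varphi(x)/x=0$ and $\lim_{x\to\infty}\varphi(x)/x=\infty$. It is a quadratic $N$-function if in addition $\varphi(x)=cx^2$ for all $|x|\le x_0$, with some $c>0$ and $x_0>0$. For $p>1$ the following is a quadratic $N$-function: $$\varphi_p(x)=\begin{cases}\frac{x^2}{2}, & |x|\le 1,\\ \frac1p|x|^p-\frac1p+\frac12, & |x|>1.\end{cases}$$ **$\varphi$-sub-Gaussian variables.** Let $\varphi$ be a quadratic $N$-function. A random variable $\xi$ is $\varphi$-sub-Gaussian under $\hat{\mathbb{E}}$ with parameters $a>0$, $\overline{m}$, $\underline{m}$ (real constants) if $$\hat{\mathbb{E}}\,e^{\lambda(\xi-\overline{m})}\le e^{\varphi(a\lambda)}\ \text{ for all }\lambda>0,\qquad \hat{\mathbb{E}}\,e^{\lambda(\xi-\underline{m})}\le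 e^{\varphi(a\lambda)}\ \text{ for all }\lambda<0.$$ For such $\xi$ with fixed $\overline{m}$ and $\underline{m}$, $$\tau_\varphi(\xi)=\inf\Big\{a\ge0:\ \hat{\mathbb{E}}\,e^{\lambda(\xi-\overline{m})}\le e^{\varphi(a\lambda)}\text{ for all }\lambda>0,\ \text{and}\ \hat{\mathbb{E}}\,e^{\lambda(\xi-\underline{m})}\le e^{\varphi(a\lambda)}\text{ for all }\lambda<0\Big\}.$$ *)

theory Defs
  imports "HOL-Analysis.Analysis" "HOL-Real_Asymp.Real_Asymp"
begin

text \<open>
  A measure \<open>M\<close> is used only as a carrier of the measurable space
  \<open>(\<Omega>, \<F>) = (space M, sets M)\<close>; its measure plays no role.  Random variables are elements of
  \<open>borel_measurable M\<close> with values in \<open>ereal\<close>.  Since HOL functions are total, every relation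
  between random variables is stated pointwise on \<open>space M\<close>, so that values outside \<open>\<Omega>\<close> are
  irrelevant.  In \<open>ereal\<close> one has \<open>\<infinity> + (-\<infinity>) = \<infinity>\<close>, hence the explicit exclusion of this case in
  \<open>subadditive\<close>; and \<open>0 * \<infinity> = 0\<close>.
\<close>

locale sub_linear_expectation =
  fixes M :: "'a measure"
    and H :: "('a \<Rightarrow> ereal) set"
    and E :: "('a \<Rightarrow> ereal) \<Rightarrow> ereal"
  assumes space_nonempty: "space M \<noteq> {}"
    and random_variables: "H \<subseteq> borel_measurable M"
    and nonneg_in_H:
      "\<And>X. X \<in> borel_measurable M \<Longrightarrow> \<forall>\<omega>\<in>space M. 0 \<le> X \<omega> \<Longrightarrow> X \<in> H"
    and monotone:
      "\<And>X Y. X \<in> H \<Longrightarrow> Y \<in> H \<Longrightarrow> \<forall>\<omega>\<in>space M. X \<omega> \<le> Y \<omega> \<Longrightarrow> E X \<le> E Y"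
    and constant_preserving:
      "\<And>X (c::real). X \<in> H \<Longrightarrow> \<forall>\<omega>\<in>space M. X \<omega> = ereal c \<Longrightarrow> E X = ereal c"
    and subadditive:
      "\<And>X Y S. X \<in> H \<Longrightarrow> Y \<in> H \<Longrightarrow> S \<in> H \<Longrightarrow>
         \<forall>\<omega>\<in>space M. {X \<omega>, Y \<omega>} \<noteq> {\<infinity>, -\<infinity>} \<and> S \<omega> = X \<omega> + Y \<omega> \<Longrightarrow>
         {E X, E Y} \<noteq> {\<infinity>, -\<infinity>} \<Longrightarrow> E S \<le> E X + E Y"
    and pos_homogeneous:
      "\<And>X Y (l::real). X \<in> H \<Longrightarrow> Y \<in> H \<Longrightarrow> 0 \<le> l \<Longrightarrow>
         \<forall>\<omega>\<in>space M. Y \<omega> = ereal l * X \<omega> \<Longrightarrow> E Y = ereal l * E X"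
    and monotone_convergence:
      "\<And>Xs X. (\<And>n::nat. Xs n \<in> H) \<Longrightarrow> X \<in> H \<Longrightarrow> \<forall>\<omega>\<in>space M. 0 \<le> Xs 0 \<omega> \<Longrightarrow>
         \<forall>\<omega>\<in>space M. incseq (\<lambda>n. Xs n \<omega>) \<and> (\<lambda>n. Xs n \<omega>) \<longlonglongrightarrow> X \<omega> \<Longrightarrow>
         incseq (\<lambda>n. E (Xs n)) \<and> (\<lambda>n. E (Xs n)) \<longlonglongrightarrow> E X"

definition upper_probability :: "(('a \<Rightarrow> ereal) \<Rightarrow> ereal) \<Rightarrow> 'a set \<Rightarrow> ereal" where
  "upper_probability E A = E (indicator A)"

definition lower_capacity ::
    "'a measure \<Rightarrow> (('a \<Rightarrow> ereal) \<Rightarrow> ereal) \<Rightarrow> 'a set \<Rightarrow> ereal" where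
  "lower_capacity M E A = 1 - upper_probability E (space M - A)"

text \<open>
  Increasing is read strictly: a convex even function vanishing at 0 is non-decreasing on
  \<open>x > 0\<close> anyway.
\<close>

definition N_function :: "(real \<Rightarrow> real) \<Rightarrow> bool" where
  "N_function \<phi> \<longleftrightarrow>
     continuous_on UNIV \<phi> \<and> (\<forall>x. \<phi> (- x) = \<phi> x) \<and> convex_on UNIV \<phi> \<and> \<phi> 0 = 0 \<and>
     strict_mono_on {0<..} \<phi> \<and>
     ((\<lambda>x. \<phi> x / x) \<longlongrightarrow> 0) (at 0) \<and> filterlim (\<lambda>x. \<phi> x / x) at_top at_top"

definition quadratic_N_function :: "(real \<Rightarrow> real) \<Rightarrow> bool" where
  "quadratic_N_function \<phi> \<longleftrightarrow>
     N_function \<phi> \<and> (\<exists>c>0. \<exists>x\<^sub>0>0. \<forall>x. \<bar>x\<bar> \<le> x\<^sub>0 \<longrightarrow> \<phi> x = c * x\<^sup>2)"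

definition phi_p :: "real \<Rightarrow> real \<Rightarrow> real" where
  "phi_p p x = (if \<bar>x\<bar> \<le> 1 then x\<^sup>2 / 2 else 1 / p * \<bar>x\<bar> powr p - 1 / p + 1 / 2)"

lemma phi_p_deriv:
  assumes p: "p > 1"
  shows "(phi_p p has_real_derivative
           (if x \<in> {-1..1} then x else sgn x * \<bar>x\<bar> powr (p - 1))) (at x)"
proof -
  let ?S = "{-1..1::real}" and ?T = "{..-1} \<union> {1..} :: real set"
  let ?g = "\<lambda>x. 1 / p * \<bar>x\<bar> powr p - 1 / p + 1 / 2"
  have closS: "closure ?S = ?S" by simp
  have closT: "closure ?T = ?T" by (simp add: closed_Un)
  have g: "(?g has_real_derivative sgn y * \<bar>y\<bar> powr (p - 1)) (at y)" if "y \<in> ?T" for y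
  proof (cases "y > 0")
    case True
    have "((\<lambda>x. 1 / p * x powr p - 1 / p + 1 / 2) has_real_derivative y powr (p - 1)) (at y)"
      using True p by (auto intro!: derivative_eq_intros)
    then have "(?g has_real_derivative y powr (p - 1)) (at y)"
      by (rule has_field_derivative_transform_within_open[where S = "{0<..}"]) (use True in auto)
    then show ?thesis using True by simp
  next
    case False
    then have neg: "y < 0" using that by auto
    have "((\<lambda>x. 1 / p * (- x) powr p - 1 / p + 1 / 2) has_real_derivative - ((- y) powr (p - 1))) (at y)"
      using neg p by (auto intro!: derivative_eq_intros)
    then have "(?g has_real_derivative - ((- y) powr (p - 1))) (at y)"
      by (rule has_field_derivative_transform_within_open[where S = "{..<0}"]) (use neg in auto)
    then show ?thesis using neg by simp
  qed
  have sq: "((\<lambda>x. x\<^sup>2 / 2) has_real_derivative x) (at x within A)" for A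
    by (auto intro!: derivative_eq_intros)
  have "((\<lambda>x. if x \<in> ?S then x\<^sup>2 / 2 else ?g x) has_vector_derivative
     (if x \<in> ?S then x else sgn x * \<bar>x\<bar> powr (p - 1))) (at x within UNIV)"
  proof (rule has_vector_derivative_If_within_closures[where T = ?T and f' = "\<lambda>x. x"])
    show "x \<in> ?S \<union> ?T" "UNIV = ?S \<union> ?T" by auto
    show "((\<lambda>x. x\<^sup>2 / 2) has_vector_derivative x) (at x within ?S \<union> closure ?S \<inter> closure ?T)"
      using sq has_real_derivative_iff_has_vector_derivative by blast
    show "(?g has_vector_derivative sgn x * \<bar>x\<bar> powr (p - 1))
        (at x within ?T \<union> closure ?S \<inter> closure ?T)"
      if "x \<in> ?T \<union> closure ?S \<inter> closure ?T"
    proof -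
      have "x \<in> ?T" using that closT by blast
      from has_field_derivative_at_within[OF g[OF this]] show ?thesis
        using has_real_derivative_iff_has_vector_derivative by blast
    qed
    assume "x \<in> closure ?S" "x \<in> closure ?T"
    then have "x \<in> ?S" "x \<in> ?T" unfolding closS closT by blast+
    then have "x = 1 \<or> x = -1" by auto
    then show "x\<^sup>2 / 2 = ?g x" "x = sgn x * \<bar>x\<bar> powr (p - 1)" by auto
  qed
  then have "((\<lambda>x. if x \<in> ?S then x\<^sup>2 / 2 else ?g x) has_real_derivative
     (if x \<in> ?S then x else sgn x * \<bar>x\<bar> powr (p - 1))) (at x)"
    by (rule has_real_derivative_iff_has_vector_derivative[THEN iffD2])
  then show ?thesis
    by (rule has_field_derivative_transform_within_open[where S = UNIV])
       (auto simp: phi_p_def abs_le_iff)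
qed

lemma quadratic_N_function_phi_p:
  assumes p: "p > 1"
  shows "quadratic_N_function (phi_p p)"
proof -
  define D where "D x = (if x \<in> {-1..1} then x else sgn x * \<bar>x\<bar> powr (p - 1))" for x
  have D: "(phi_p p has_real_derivative D x) (at x)" for x
    unfolding D_def by (rule phi_p_deriv[OF p])
  have ge1: "x powr (p - 1) \<ge> 1" if "x \<ge> 1" for x
    using that p by (intro ge_one_powr_ge_zero) auto
  have le: "D x \<le> D y" if "x \<le> y" for x y
  proof -
    have D_in: "D z = z" if "-1 \<le> z" "z \<le> 1" for z using that by (simp add: D_def)
    have D_gt: "D z = z powr (p - 1)" if "z > 1" for z using that by (simp add: D_def)
    have D_lt: "D z = - ((- z) powr (p - 1))" if "z < -1" for z using that by (simp add: D_def)
    have "z < -1 \<or> (-1 \<le> z \<and> z \<le> 1) \<or> z > 1" for z :: real by linarith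
    from this[of x] this[of y] show ?thesis
      using that p ge1[of "- x"] ge1[of y]
        powr_mono2[of "p - 1" "- y" "- x"] powr_mono2[of "p - 1" x y]
      by (elim disjE conjE) (simp_all add: D_in D_gt D_lt)
  qed
  have D_pos: "D x > 0" if "x > 0" for x
    using that by (auto simp: D_def)
  have "continuous_on UNIV (phi_p p)"
    using D by (meson DERIV_isCont continuous_at_imp_continuous_on)
  moreover have "convex_on UNIV (phi_p p)"
    using D le by (intro convex_on_realI[where f' = D]) auto
  moreover have "strict_mono_on {0<..} (phi_p p)"
  proof (rule strict_mono_onI)
    fix r s :: real assume rs: "r \<in> {0<..}" "s \<in> {0<..}" "r < s"
    show "phi_p p r < phi_p p s"
      using rs D D_pos by (intro DERIV_pos_imp_increasing[OF \<open>r < s\<close>]) (auto intro!: exI[of _ "D _"])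
  qed
  moreover have "((\<lambda>x. phi_p p x / x) \<longlongrightarrow> 0) (at 0)"
    using D[of 0] by (simp add: has_field_derivative_iff D_def phi_p_def)
  moreover have "filterlim (\<lambda>x. phi_p p x / x) at_top at_top"
  proof -
    have "filterlim (\<lambda>x. (1 / p * x powr p - 1 / p + 1 / 2) / x) at_top at_top"
      using p by real_asymp
    moreover have "eventually (\<lambda>x. (1 / p * x powr p - 1 / p + 1 / 2) / x = phi_p p x / x) at_top"
      using eventually_gt_at_top[of 1] by eventually_elim (simp add: phi_p_def)
    ultimately show ?thesis
      using filterlim_cong by fast
  qed
  moreover have "\<exists>c>0. \<exists>x\<^sub>0>0. \<forall>x. \<bar>x\<bar> \<le> x\<^sub>0 \<longrightarrow> phi_p p x = c * x\<^sup>2"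
    by (rule exI[of _ "1/2"], simp, rule exI[of _ 1]) (simp add: phi_p_def)
  ultimately show ?thesis
    by (simp add: quadratic_N_function_def N_function_def phi_p_def)
qed

definition exp_ereal :: "ereal \<Rightarrow> ereal" where
  "exp_ereal x = (case x of ereal r \<Rightarrow> ereal (exp r) | PInfty \<Rightarrow> \<infinity> | MInfty \<Rightarrow> 0)"

definition sub_gaussian_bound ::
    "(('a \<Rightarrow> ereal) \<Rightarrow> ereal) \<Rightarrow> (real \<Rightarrow> real) \<Rightarrow> real \<Rightarrow> real \<Rightarrow> ('a \<Rightarrow> ereal) \<Rightarrow> real \<Rightarrow> bool" where
  "sub_gaussian_bound E \<phi> m_up m_lo \<xi> a \<longleftrightarrow>
     (\<forall>l>0. E (\<lambda>\<omega>. exp_ereal (ereal l * (\<xi> \<omega> - ereal m_up))) \<le> ereal (exp (\<phi> (a * l)))) \<and>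
     (\<forall>l<0. E (\<lambda>\<omega>. exp_ereal (ereal l * (\<xi> \<omega> - ereal m_lo))) \<le> ereal (exp (\<phi> (a * l))))"

definition sub_gaussian ::
    "'a measure \<Rightarrow> (('a \<Rightarrow> ereal) \<Rightarrow> ereal) \<Rightarrow> (real \<Rightarrow> real) \<Rightarrow> real \<Rightarrow> real \<Rightarrow> real \<Rightarrow>
     ('a \<Rightarrow> ereal) \<Rightarrow> bool" where
  "sub_gaussian M E \<phi> a m_up m_lo \<xi> \<longleftrightarrow>
     quadratic_N_function \<phi> \<and> \<xi> \<in> borel_measurable M \<and> a > 0 \<and>
     sub_gaussian_bound E \<phi> m_up m_lo \<xi> a"

text \<open>
  For a sub-Gaussian variable the set below is non-empty and bounded below by 0, so its real
  infimum is the intended one.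
\<close>

definition tau ::
    "(('a \<Rightarrow> ereal) \<Rightarrow> ereal) \<Rightarrow> (real \<Rightarrow> real) \<Rightarrow> real \<Rightarrow> real \<Rightarrow> ('a \<Rightarrow> ereal) \<Rightarrow> real" where
  "tau E \<phi> m_up m_lo \<xi> = Inf {a. a \<ge> 0 \<and> sub_gaussian_bound E \<phi> m_up m_lo \<xi> a}"

end

theory Submission
  imports Defs
begin

text \<open>
  Put \<open>a\<^sub>n = 2 c n powr (-\<alpha>)\<close>, which exceeds \<open>\<tau>(Z\<^sub>n)\<close>, so that the exponential
  bounds hold for \<open>Z\<^sub>n\<close> with parameter \<open>a\<^sub>n\<close>.  At \<open>\<lambda> = 1 / a\<^sub>n\<close> they read
  \<open>E exp ((Z\<^sub>n - m_up) / a\<^sub>n) \<le> exp (\<phi> 1)\<close>, with the same right-hand side for every \<open>n\<close>,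
  so only the value \<open>\<phi> 1\<close> enters.  This choice of \<open>\<lambda>\<close> is crude, but the
  decay of \<open>a\<^sub>n\<close> leaves room for it: with \<open>\<delta>\<^sub>n = n powr (-\<alpha>/2)\<close> one has
  \<open>\<delta>\<^sub>n \<rightarrow> 0\<close> while \<open>\<delta>\<^sub>n / a\<^sub>n\<close> is a positive power of \<open>n\<close>, so the variables
  \<open>Y\<^sub>n = exp ((Z\<^sub>n - m_up - \<delta>\<^sub>n) / a\<^sub>n)\<close> have summable expectations.

  Positivity, sub-additivity and monotone convergence make \<open>E\<close> countably sub-additive on
  non-negative variables (\<open>expectation_suminf_le\<close>), so \<open>\<Sum>n. Y\<^sub>n\<close> has finite expectation
  and is finite quasi-surely (\<open>upper_probability_zero_if_series_diverges\<close>).  If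
  \<open>limsup Z\<^sub>n > m_up\<close>, then for some \<open>d > 0\<close> there are infinitely many \<open>n\<close> with
  \<open>Z\<^sub>n - m_up \<ge> d \<ge> \<delta>\<^sub>n\<close>; each of them gives \<open>Y\<^sub>n \<ge> 1\<close>, so the series
  diverges.  This is a Borel--Cantelli argument in which the vanishing \<open>\<delta>\<^sub>n\<close> saves the union
  over all \<open>d\<close>.  The lower bound is the same statement for \<open>m_lo - Z\<^sub>n\<close>.
\<close>

section \<open>Sub-linear expectation of non-negative variables\<close>

context sub_linear_expectation
begin

lemma expectation_nonneg:
  assumes "X \<in> borel_measurable M" "\<And>\<omega>. \<omega> \<in> space M \<Longrightarrow> 0 \<le> X \<omega>"
  shows "0 \<le> E X"
proof -
  have "(\<lambda>_. 0) \<in> H" by (rule nonneg_in_H) auto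
  then have "E (\<lambda>_. 0) = ereal 0" and "E (\<lambda>_. 0) \<le> E X"
    using assms by (auto intro!: constant_preserving monotone nonneg_in_H simp: zero_ereal_def)
  then show ?thesis by (simp add: zero_ereal_def)
qed

lemma expectation_mono:
  assumes "X \<in> borel_measurable M" "Y \<in> borel_measurable M"
    and "\<And>\<omega>. \<omega> \<in> space M \<Longrightarrow> 0 \<le> X \<omega>" "\<And>\<omega>. \<omega> \<in> space M \<Longrightarrow> X \<omega> \<le> Y \<omega>"
  shows "E X \<le> E Y"
  using assms by (intro monotone nonneg_in_H) (auto intro: order_trans)

lemma expectation_cmult:
  assumes "X \<in> borel_measurable M" "\<And>\<omega>. \<omega> \<in> space M \<Longrightarrow> 0 \<le> X \<omega>" "0 \<le> l"
  shows "E (\<lambda>\<omega>. ereal l * X \<omega>) = ereal l * E X"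
  using assms by (intro pos_homogeneous nonneg_in_H) auto

lemma expectation_add_le:
  assumes "X \<in> borel_measurable M" "Y \<in> borel_measurable M"
    and "\<And>\<omega>. \<omega> \<in> space M \<Longrightarrow> 0 \<le> X \<omega>" "\<And>\<omega>. \<omega> \<in> space M \<Longrightarrow> 0 \<le> Y \<omega>"
  shows "E (\<lambda>\<omega>. X \<omega> + Y \<omega>) \<le> E X + E Y"
proof (rule subadditive)
  show "\<forall>\<omega>\<in>space M. {X \<omega>, Y \<omega>} \<noteq> {\<infinity>, -\<infinity>} \<and> X \<omega> + Y \<omega> = X \<omega> + Y \<omega>"
    using assms(3,4) by (force simp: doubleton_eq_iff)
  show "{E X, E Y} \<noteq> {\<infinity>, -\<infinity>}"
    using expectation_nonneg[of X] expectation_nonneg[of Y] assms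
    by (force simp: doubleton_eq_iff)
qed (use assms in \<open>auto intro!: nonneg_in_H\<close>)

lemma expectation_sum_le:
  fixes X :: "nat \<Rightarrow> 'a \<Rightarrow> ereal"
  assumes [measurable]: "\<And>n. X n \<in> borel_measurable M"
    and nonneg: "\<And>n \<omega>. \<omega> \<in> space M \<Longrightarrow> 0 \<le> X n \<omega>"
  shows "E (\<lambda>\<omega>. \<Sum>i<n. X i \<omega>) \<le> (\<Sum>i<n. E (X i))"
proof (induction n)
  case 0
  have "E (\<lambda>_. 0) = ereal 0"
    by (rule constant_preserving) (auto intro!: nonneg_in_H simp: zero_ereal_def)
  then show ?case by (simp add: zero_ereal_def)
next
  case (Suc n)
  have "E (\<lambda>\<omega>. (\<Sum>i<n. X i \<omega>) + X n \<omega>) \<le> E (\<lambda>\<omega>. \<Sum>i<n. X i \<omega>) + E (X n)"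
    by (rule expectation_add_le) (auto intro!: sum_nonneg nonneg)
  with Suc show ?case by (auto intro: order_trans add_right_mono)
qed

lemma expectation_suminf_le:
  fixes X :: "nat \<Rightarrow> 'a \<Rightarrow> ereal"
  assumes [measurable]: "\<And>n. X n \<in> borel_measurable M"
    and nonneg: "\<And>n \<omega>. \<omega> \<in> space M \<Longrightarrow> 0 \<le> X n \<omega>"
  shows "E (\<lambda>\<omega>. \<Sum>i. X i \<omega>) \<le> (\<Sum>i. E (X i))"
proof (rule LIMSEQ_le_const2)
  have "(\<lambda>n. \<Sum>i<n. X i \<omega>) \<longlonglongrightarrow> (\<Sum>i. X i \<omega>)" if "\<omega> \<in> space M" for \<omega>
    by (intro summable_LIMSEQ summable_ereal_pos nonneg that)
  moreover have "incseq (\<lambda>n. \<Sum>i<n. X i \<omega>)" if "\<omega> \<in> space M" for \<omega>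
    using nonneg that by (intro incseq_sumI)
  ultimately show "(\<lambda>n. E (\<lambda>\<omega>. \<Sum>i<n. X i \<omega>)) \<longlonglongrightarrow> E (\<lambda>\<omega>. \<Sum>i. X i \<omega>)"
    by (intro monotone_convergence[THEN conjunct2] nonneg_in_H)
       (auto intro!: sum_nonneg suminf_nonneg summable_ereal_pos nonneg)
  have "E (\<lambda>\<omega>. \<Sum>i<n. X i \<omega>) \<le> (\<Sum>i. E (X i))" for n
  proof (rule order_trans)
    show "E (\<lambda>\<omega>. \<Sum>i<n. X i \<omega>) \<le> (\<Sum>i<n. E (X i))"
      by (rule expectation_sum_le[OF assms])
    show "(\<Sum>i<n. E (X i)) \<le> (\<Sum>i. E (X i))"
      by (intro sum_le_suminf summable_ereal_pos) (auto intro!: expectation_nonneg nonneg)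
  qed
  then show "\<exists>N. \<forall>n\<ge>N. E (\<lambda>\<omega>. \<Sum>i<n. X i \<omega>) \<le> (\<Sum>i. E (X i))"
    by simp
qed

section \<open>Null events\<close>

lemma upper_probability_nonneg:
  assumes "A \<in> sets M"
  shows "0 \<le> upper_probability E A"
  using assms unfolding upper_probability_def by (intro expectation_nonneg) auto

lemma upper_probability_Un_null:
  assumes "A \<in> sets M" "B \<in> sets M"
    and "upper_probability E A = 0" "upper_probability E B = 0"
  shows "upper_probability E (A \<union> B) = 0"
proof (rule antisym)
  have "upper_probability E (A \<union> B) \<le> E (\<lambda>\<omega>. indicator A \<omega> + indicator B \<omega>)"
    unfolding upper_probability_def using assms(1,2)
    by (intro expectation_mono) (auto simp: indicator_def)
  also have "\<dots> \<le> E (indicator A) + E (indicator B)"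
    using assms(1,2) by (intro expectation_add_le) auto
  finally show "upper_probability E (A \<union> B) \<le> 0"
    using assms(3,4) by (simp add: upper_probability_def)
qed (use assms in \<open>auto intro!: upper_probability_nonneg\<close>)

text \<open>
  If \<open>W = \<infinity>\<close> on \<open>A\<close>, then \<open>k I\<^sub>A \<le> W\<close> for every \<open>k \<ge> 0\<close>, hence
  \<open>k V(A) \<le> E W\<close> for every \<open>k\<close>; a finite \<open>E W\<close> leaves only \<open>V(A) = 0\<close>.
\<close>

lemma upper_probability_zero_if_infinite:
  assumes W: "W \<in> borel_measurable M" "\<And>\<omega>. \<omega> \<in> space M \<Longrightarrow> 0 \<le> W \<omega>" "E W < \<infinity>"
    and A: "A \<in> sets M" "\<And>\<omega>. \<omega> \<in> A \<Longrightarrow> W \<omega> = \<infinity>"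
  shows "upper_probability E A = 0"
proof -
  have bound: "ereal k * upper_probability E A \<le> E W" if "0 \<le> k" for k
  proof -
    have "ereal k * upper_probability E A = E (\<lambda>\<omega>. ereal k * indicator A \<omega>)"
      unfolding upper_probability_def using A that by (intro expectation_cmult[symmetric]) auto
    also have "\<dots> \<le> E W"
      using A W that by (intro expectation_mono) (auto simp: indicator_def)
    finally show ?thesis .
  qed
  have fin: "0 \<le> upper_probability E A" "upper_probability E A \<le> E W" "0 \<le> E W"
    using upper_probability_nonneg[OF A(1)] bound[of 1] expectation_nonneg[OF W(1,2)]
    by (auto simp: one_ereal_def[symmetric])
  with W(3) obtain v w where vw: "upper_probability E A = ereal v" "E W = ereal w" "0 \<le> v" "0 \<le> w"
    by (cases "upper_probability E A"; cases "E W") auto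
  have "v = 0"
  proof (rule ccontr)
    assume "v \<noteq> 0"
    then have "(w + 1) / v * v \<le> w" using bound[of "(w + 1) / v"] vw by simp
    with \<open>v \<noteq> 0\<close> show False by simp
  qed
  with vw show ?thesis by simp
qed

lemma upper_probability_zero_if_series_diverges:
  fixes Y :: "nat \<Rightarrow> 'a \<Rightarrow> ereal"
  assumes Y: "\<And>n. Y n \<in> borel_measurable M" "\<And>n \<omega>. \<omega> \<in> space M \<Longrightarrow> 0 \<le> Y n \<omega>"
    and bound: "\<And>n. E (Y n) \<le> ereal (b n)" "summable b"
    and A: "A \<in> sets M" "\<And>\<omega>. \<omega> \<in> A \<Longrightarrow> (\<Sum>n. Y n \<omega>) = \<infinity>"
  shows "upper_probability E A = 0"
proof (rule upper_probability_zero_if_infinite[where W = "\<lambda>\<omega>. \<Sum>n. Y n \<omega>"])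
  have "E (\<lambda>\<omega>. \<Sum>n. Y n \<omega>) \<le> (\<Sum>n. E (Y n))"
    by (intro expectation_suminf_le Y)
  also have "\<dots> \<le> (\<Sum>n. ereal (b n))"
    by (intro suminf_le summable_ereal_pos bound order_trans[OF _ bound(1)] expectation_nonneg Y)
  also have "\<dots> < \<infinity>" using suminf_ereal_finite[OF bound(2)] by simp
  finally show "E (\<lambda>\<omega>. \<Sum>n. Y n \<omega>) < \<infinity>" .
qed (use Y A in \<open>auto intro!: borel_measurable_suminf_order suminf_nonneg summable_ereal_pos\<close>)

end

text \<open>The terms of a series with finite sum tend to zero.\<close>

lemma suminf_ereal_eq_PInf_if_frequently_ge_1:
  fixes y :: "nat \<Rightarrow> ereal"
  assumes nonneg: "\<And>n. 0 \<le> y n" and freq: "\<exists>\<^sub>F n in sequentially. 1 \<le> y n"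
  shows "(\<Sum>n. y n) = \<infinity>"
proof (rule ccontr)
  assume fin: "(\<Sum>n. y n) \<noteq> \<infinity>"
  have real: "ereal (real_of_ereal (y n)) = y n" for n
    using suminf_PInfty[OF nonneg fin, of n] nonneg[of n] by (simp add: ereal_real)
  have "summable (\<lambda>n. real_of_ereal (y n))"
    by (rule summable_real_of_ereal[OF nonneg fin])
  then have "(\<lambda>n. real_of_ereal (y n)) \<longlonglongrightarrow> 0" by (rule summable_LIMSEQ_zero)
  then have "\<forall>\<^sub>F n in sequentially. real_of_ereal (y n) < 1"
    by (rule order_tendstoD) simp
  then have "\<forall>\<^sub>F n in sequentially. \<not> 1 \<le> y n"
    by eventually_elim (metis real ereal_less(3) less_le_not_le not_le)
  with freq show False by (simp add: frequently_def)
qed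

section \<open>The exponential function on the extended reals\<close>

lemma exp_ereal_nonneg: "0 \<le> exp_ereal x"
  by (cases x) (auto simp: exp_ereal_def)

lemma exp_ereal_mono: "x \<le> y \<Longrightarrow> exp_ereal x \<le> exp_ereal y"
  by (cases x; cases y) (auto simp: exp_ereal_def)

lemma measurable_exp_ereal [measurable]: "exp_ereal \<in> borel_measurable borel"
proof -
  have "exp_ereal = (\<lambda>x. if x = \<infinity> then \<infinity> else if x = -\<infinity> then 0 else ereal (exp (real_of_ereal x)))"
    by (rule ext, case_tac x) (auto simp: exp_ereal_def)
  also have "\<dots> \<in> borel_measurable borel" by measurable
  finally show ?thesis .
qed

section \<open>Exponential bounds and the upper limit\<close>

text \<open>
  The number \<open>a n\<close> is the scale on which \<open>U n\<close> has exponential moments that are uniformly bounded,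
  and \<open>\<delta> n\<close> is an error that tends to zero but is large compared with that scale.
\<close>

lemma (in sub_linear_expectation) upper_probability_limsup_pos_zero:
  fixes U :: "nat \<Rightarrow> 'a \<Rightarrow> ereal"
  assumes [measurable]: "\<And>n. U n \<in> borel_measurable M"
    and a: "\<And>n. 0 < a n"
    and bound: "\<And>n. E (\<lambda>\<omega>. exp_ereal (ereal (1 / a n) * U n \<omega>)) \<le> ereal K"
    and \<delta>: "\<delta> \<longlonglongrightarrow> 0" "summable (\<lambda>n. exp (- (\<delta> n / a n)))"
  shows "upper_probability E {\<omega> \<in> space M. 0 < limsup (\<lambda>n. U n \<omega>)} = 0"
proof (rule upper_probability_zero_if_series_diverges)
  define Y where "Y n \<omega> = ereal (exp (- (\<delta> n / a n))) * exp_ereal (ereal (1 / a n) * U n \<omega>)" for n \<omega>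
  show [measurable]: "Y n \<in> borel_measurable M" for n
    unfolding Y_def by measurable
  show Y_nonneg: "0 \<le> Y n \<omega>" for n \<omega>
    by (simp add: Y_def exp_ereal_nonneg)
  show "E (Y n) \<le> ereal (exp (- (\<delta> n / a n)) * K)" for n
  proof -
    have "E (Y n) = ereal (exp (- (\<delta> n / a n))) * E (\<lambda>\<omega>. exp_ereal (ereal (1 / a n) * U n \<omega>))"
      unfolding Y_def by (rule expectation_cmult) (auto simp: exp_ereal_nonneg)
    also have "\<dots> \<le> ereal (exp (- (\<delta> n / a n))) * ereal K"
      by (intro ereal_mult_left_mono bound) auto
    finally show ?thesis by simp
  qed
  show "summable (\<lambda>n. exp (- (\<delta> n / a n)) * K)" by (intro summable_mult2 \<delta>)
  show "{\<omega> \<in> space M. 0 < limsup (\<lambda>n. U n \<omega>)} \<in> sets M" by measurable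
  fix \<omega> assume "\<omega> \<in> {\<omega> \<in> space M. 0 < limsup (\<lambda>n. U n \<omega>)}"
  then have "\<not> limsup (\<lambda>n. U n \<omega>) \<le> 0" by (auto simp: not_le)
  then obtain y where "0 < y" and y: "\<exists>\<^sub>F n in sequentially. y \<le> U n \<omega>"
    unfolding Limsup_le_iff frequently_def by (auto simp: not_less not_le)
  \<comment> \<open>The level \<open>y\<close> may be infinite, hence a real \<open>d\<close> below it.\<close>
  then obtain d where d: "0 < d" "ereal d < y"
    using ereal_dense2[of 0 y] by auto
  have "\<forall>\<^sub>F n in sequentially. \<delta> n < d"
    using \<delta>(1) d(1) by (rule order_tendstoD)
  with y have "\<exists>\<^sub>F n in sequentially. y \<le> U n \<omega> \<and> \<delta> n < d"
    by (subst conj_commute) (rule frequently_eventually_conj)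
  then have "\<exists>\<^sub>F n in sequentially. 1 \<le> Y n \<omega>"
  proof (rule frequently_elim1, safe)
    fix n assume n: "y \<le> U n \<omega>" "\<delta> n < d"
    have "ereal (\<delta> n) \<le> U n \<omega>"
      using n d(2) by (meson ereal_less_eq(3) less_imp_le order_trans)
    then have "ereal (1 / a n) * ereal (\<delta> n) \<le> ereal (1 / a n) * U n \<omega>"
      using a[of n] by (intro ereal_mult_left_mono) auto
    then have "ereal (exp (\<delta> n / a n)) \<le> exp_ereal (ereal (1 / a n) * U n \<omega>)"
      using exp_ereal_mono by (fastforce simp: exp_ereal_def)
    then have "ereal (exp (- (\<delta> n / a n))) * ereal (exp (\<delta> n / a n)) \<le> Y n \<omega>"
      unfolding Y_def by (intro ereal_mult_left_mono) auto
    then show "1 \<le> Y n \<omega>" by (simp add: exp_minus one_ereal_def)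
  qed
  then show "(\<Sum>n. Y n \<omega>) = \<infinity>"
    by (intro suminf_ereal_eq_PInf_if_frequently_ge_1 Y_nonneg)
qed

section \<open>Monotonicity of the sub-Gaussian bound in its parameter\<close>

text \<open>Convexity at the midpoint \<open>0\<close> of \<open>x\<close> and \<open>- x\<close>, where \<open>\<phi>\<close> takes equal values.\<close>

lemma N_function_nonneg:
  assumes "N_function \<phi>"
  shows "0 \<le> \<phi> x"
proof -
  have "convex_on UNIV \<phi>" "\<phi> (- x) = \<phi> x" "\<phi> 0 = 0" using assms by (auto simp: N_function_def)
  with convex_onD[of UNIV \<phi> "1/2" x "- x"] show ?thesis by simp
qed

lemma N_function_mono:
  assumes "N_function \<phi>" "\<bar>x\<bar> \<le> \<bar>y\<bar>"
  shows "\<phi> x \<le> \<phi> y"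
proof -
  have even: "\<phi> z = \<phi> \<bar>z\<bar>" for z using assms(1) by (auto simp: N_function_def abs_if)
  have "\<phi> \<bar>x\<bar> \<le> \<phi> \<bar>y\<bar>"
  proof (cases "x = 0 \<or> \<bar>x\<bar> = \<bar>y\<bar>")
    case True
    then show ?thesis using N_function_nonneg[OF assms(1)] assms(1) by (auto simp: N_function_def)
  next
    case False
    with assms show ?thesis
      by (auto simp: N_function_def intro!: less_imp_le strict_mono_onD[of "{0<..}" \<phi>])
  qed
  with even show ?thesis by metis
qed

lemma sub_gaussian_bound_mono:
  assumes "N_function \<phi>" "sub_gaussian_bound E \<phi> m_up m_lo \<xi> a" "0 \<le> a" "a \<le> b"
  shows "sub_gaussian_bound E \<phi> m_up m_lo \<xi> b"
proof -
  have "\<phi> (a * l) \<le> \<phi> (b * l)" for l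
    using assms(3,4) by (intro N_function_mono[OF assms(1)]) (simp add: abs_mult mult_right_mono)
  then have "ereal (exp (\<phi> (a * l))) \<le> ereal (exp (\<phi> (b * l)))" for l by simp
  with assms(2) show ?thesis unfolding sub_gaussian_bound_def by (meson order_trans)
qed

text \<open>
  The admissible parameters form an upward closed set, so every number above their infimum
  \<open>\<tau>\<close> is admissible; whether \<open>\<tau>\<close> itself is admissible is a separate question, which
  a strict inequality avoids.
\<close>

lemma sub_gaussian_bound_if_tau_less:
  assumes \<xi>: "sub_gaussian M E \<phi> a m_up m_lo \<xi>" and "tau E \<phi> m_up m_lo \<xi> < b"
  shows "sub_gaussian_bound E \<phi> m_up m_lo \<xi> b"
proof -
  let ?S = "{a. a \<ge> 0 \<and> sub_gaussian_bound E \<phi> m_up m_lo \<xi> a}"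
  have "a \<in> ?S" using \<xi> by (simp add: sub_gaussian_def)
  with assms(2) obtain a' where "a' \<in> ?S" "a' < b"
    unfolding tau_def using cInf_lessD[of ?S b] by auto
  with \<xi> show ?thesis
    by (auto simp: sub_gaussian_def quadratic_N_function_def intro: sub_gaussian_bound_mono)
qed

lemma summable_exp_minus_powr:
  fixes \<beta> b :: real
  assumes "0 < \<beta>" "0 < b"
  shows "summable (\<lambda>n. exp (- (real (Suc n) powr \<beta> / b)))"
proof (rule summable_comparison_test_bigo)
  show "summable (\<lambda>n. norm (1 / real n ^ 2))"
    using inverse_power_summable[of 2, where 'a = real] by (simp add: field_simps)
  show "(\<lambda>n. exp (- (real (Suc n) powr \<beta> / b))) \<in> O(\<lambda>n. 1 / real n ^ 2)"
    using assms by real_asymp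
qed

section \<open>Quasi-sure bounds for the lower and upper limits\<close>

theorem theorem4p1:
  fixes M :: "'a measure"
    and H :: "('a \<Rightarrow> ereal) set"
    and E :: "('a \<Rightarrow> ereal) \<Rightarrow> ereal"
    and p m_up m_lo :: real
    and Z :: "nat \<Rightarrow> 'a \<Rightarrow> ereal"
  assumes "sub_linear_expectation M H E"
    and "p > 1"
    and "\<forall>n\<ge>1. \<exists>a. sub_gaussian M E (phi_p p) a m_up m_lo (Z n)"
    and "\<exists>c>0. \<exists>\<alpha>>0. \<forall>n\<ge>1. tau E (phi_p p) m_up m_lo (Z n) \<le> c * real n powr (- \<alpha>)"
  shows "upper_probability E
           ({\<omega> \<in> space M. liminf (\<lambda>n. Z n \<omega>) < ereal m_lo} \<union>
            {\<omega> \<in> space M. limsup (\<lambda>n. Z n \<omega>) > ereal m_up}) = 0 \<and>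
         lower_capacity M E
           {\<omega> \<in> space M. ereal m_lo \<le> liminf (\<lambda>n. Z n \<omega>) \<and>
              liminf (\<lambda>n. Z n \<omega>) \<le> limsup (\<lambda>n. Z n \<omega>) \<and>
              limsup (\<lambda>n. Z n \<omega>) \<le> ereal m_up} = 1"
proof -
  interpret sub_linear_expectation M H E by fact
  obtain c \<alpha> where c: "c > 0" and \<alpha>: "\<alpha> > 0"
    and tau: "\<And>n. n \<ge> 1 \<Longrightarrow> tau E (phi_p p) m_up m_lo (Z n) \<le> c * real n powr (- \<alpha>)"
    using assms(4) by auto
  \<comment> \<open>The hypotheses concern \<open>n \<ge> 1\<close> only, so the sequence is shifted.\<close>
  define X where "X n = Z (Suc n)" for n
  \<comment> \<open>The factor 2 makes \<open>a n\<close> strictly larger than \<open>\<tau>\<close>; the exponent of \<open>\<delta>\<close> lies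
    between \<open>- \<alpha>\<close> and \<open>0\<close>, so that \<open>\<delta>\<close> vanishes more slowly than \<open>a\<close>.\<close>
  define a where "a n = 2 * c * real (Suc n) powr (- \<alpha>)" for n
  define \<delta> where "\<delta> n = real (Suc n) powr (- \<alpha> / 2)" for n
  have X [measurable]: "X n \<in> borel_measurable M" for n
    using assms(3) unfolding X_def sub_gaussian_def by auto
  have a_pos: "a n > 0" for n using c by (simp add: a_def)
  have bound: "sub_gaussian_bound E (phi_p p) m_up m_lo (X n) (a n)" for n
  proof -
    obtain a' where "sub_gaussian M E (phi_p p) a' m_up m_lo (X n)"
      using assms(3)[rule_format, of "Suc n"] unfolding X_def by auto
    moreover have "tau E (phi_p p) m_up m_lo (X n) < a n"
    proof -
      have "c * real (Suc n) powr (- \<alpha>) < a n" using c by (simp add: a_def)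
      with tau[of "Suc n"] show ?thesis unfolding X_def by linarith
    qed
    ultimately show ?thesis by (rule sub_gaussian_bound_if_tau_less)
  qed
  have \<delta>_lim: "\<delta> \<longlonglongrightarrow> 0" unfolding \<delta>_def using \<alpha> by real_asymp
  have ratio: "\<delta> n / a n = real (Suc n) powr (\<alpha> / 2) / (2 * c)" for n
  proof -
    have "\<delta> n = real (Suc n) powr (- \<alpha>) * real (Suc n) powr (\<alpha> / 2)"
      by (simp add: \<delta>_def flip: powr_add)
    then show ?thesis by (simp add: a_def)
  qed
  have \<delta>_sum: "summable (\<lambda>n. exp (- (\<delta> n / a n)))"
    unfolding ratio using \<alpha> c by (intro summable_exp_minus_powr) auto

  have up: "upper_probability E {\<omega> \<in> space M. 0 < limsup (\<lambda>n. X n \<omega> - ereal m_up)} = 0"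
  proof (rule upper_probability_limsup_pos_zero[OF _ a_pos _ \<delta>_lim \<delta>_sum])
    fix n
    have "E (\<lambda>\<omega>. exp_ereal (ereal (1 / a n) * (X n \<omega> - ereal m_up)))
        \<le> ereal (exp (phi_p p (a n * (1 / a n))))"
      using bound[of n] a_pos[of n] unfolding sub_gaussian_bound_def by (meson zero_less_divide_1_iff)
    then show "E (\<lambda>\<omega>. exp_ereal (ereal (1 / a n) * (X n \<omega> - ereal m_up))) \<le> ereal (exp (phi_p p 1))"
      using a_pos[of n] by simp
  qed measurable
  have lo: "upper_probability E {\<omega> \<in> space M. 0 < limsup (\<lambda>n. ereal m_lo - X n \<omega>)} = 0"
  proof (rule upper_probability_limsup_pos_zero[OF _ a_pos _ \<delta>_lim \<delta>_sum])
    fix n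
    have "ereal (1 / a n) * (ereal m_lo - x) = ereal (- (1 / a n)) * (x - ereal m_lo)" for x
      using a_pos[of n] by (cases x) (auto simp: field_simps)
    moreover have "E (\<lambda>\<omega>. exp_ereal (ereal (- (1 / a n)) * (X n \<omega> - ereal m_lo)))
        \<le> ereal (exp (phi_p p (a n * - (1 / a n))))"
      using bound[of n] a_pos[of n] unfolding sub_gaussian_bound_def
      by (meson neg_less_0_iff_less zero_less_divide_1_iff)
    ultimately show "E (\<lambda>\<omega>. exp_ereal (ereal (1 / a n) * (ereal m_lo - X n \<omega>)))
        \<le> ereal (exp (phi_p p (-1)))"
      using a_pos[of n] by simp
  qed measurable

  have limsup_X: "limsup (\<lambda>n. X n \<omega> - ereal m_up) = limsup (\<lambda>n. Z n \<omega>) - ereal m_up" for \<omega>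
    using Limsup_add_ereal_right[of sequentially "- ereal m_up" "\<lambda>n. X n \<omega>"]
      limsup_shift[of "\<lambda>n. Z n \<omega>"]
    by (simp add: X_def minus_ereal_def)
  have liminf_X: "limsup (\<lambda>n. ereal m_lo - X n \<omega>) = ereal m_lo - liminf (\<lambda>n. Z n \<omega>)" for \<omega>
    using Limsup_add_ereal_left[of sequentially "ereal m_lo" "\<lambda>n. - X n \<omega>"]
      ereal_Limsup_uminus[of sequentially "\<lambda>n. X n \<omega>"] liminf_shift[of "\<lambda>n. Z n \<omega>"]
    by (simp add: X_def minus_ereal_def)
  have lo_eq: "{\<omega> \<in> space M. 0 < limsup (\<lambda>n. ereal m_lo - X n \<omega>)} =
      {\<omega> \<in> space M. liminf (\<lambda>n. Z n \<omega>) < ereal m_lo}"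
    and up_eq: "{\<omega> \<in> space M. 0 < limsup (\<lambda>n. X n \<omega> - ereal m_up)} =
      {\<omega> \<in> space M. limsup (\<lambda>n. Z n \<omega>) > ereal m_up}"
    by (auto simp: liminf_X limsup_X ereal_less_minus_iff ereal_minus_less_iff)
  let ?bad = "{\<omega> \<in> space M. liminf (\<lambda>n. Z n \<omega>) < ereal m_lo} \<union>
    {\<omega> \<in> space M. limsup (\<lambda>n. Z n \<omega>) > ereal m_up}"
  have null: "upper_probability E ?bad = 0"
    unfolding lo_eq[symmetric] up_eq[symmetric]
    by (intro upper_probability_Un_null lo up) measurable
  have "space M - {\<omega> \<in> space M. ereal m_lo \<le> liminf (\<lambda>n. Z n \<omega>) \<and>
      liminf (\<lambda>n. Z n \<omega>) \<le> limsup (\<lambda>n. Z n \<omega>) \<and> limsup (\<lambda>n. Z n \<omega>) \<le> ereal m_up} = ?bad"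
    using Liminf_le_Limsup[of sequentially] by (auto simp: not_le)
  with null show ?thesis by (simp add: lower_capacity_def)
qed

end
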